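(* Let $d$ be a metric on a real vector space $X$ and let $f(x):=d(x,0_X)$ for $x\in X$. Consider the condition $$f^2(x+y)+f^2(x-y)=2\left(f^2(x)+f^2(y)\right)\quad\text{for all } x,y\in X.\qquad(\ast)$$ The following assertions hold: (i) if $f$ is a norm induced by an inner product, then $(\ast)$ is satisfied; (ii) suppose that $f$ is positively homogeneous; if $(\ast)$ is satisfied, then $f$ is a norm induced by an inner product.
   Context: The metric $d$ is an arbitrary metric on $X$ (not assumed translation-invariant; no continuity of the vector space operations is assumed). Here $f^2(x):=(f(x))^2$. The function $f$ is positively homogeneous if $f(\lambda x)=\lambda f(x)$ for all $x\in X$ and $\lambda\ge0$. A norm $f$ is induced by an inner product $\langle\cdot,\cdot\rangle$ on $X$ if $f(x)=\sqrt{\langle x,x\rangle}$ for all $x\in X$. *)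

theory Defs
  imports "HOL-Analysis.Analysis"
begin

text \<open>
  The library's classes \<^class>\<open>real_normed_vector\<close> and \<^class>\<open>real_inner\<close> attach one fixed
  norm, metric and inner product to a type. Here the metric, the norm and the inner product are
  arbitrary functions on a bare real vector space, so the notions are stated as predicates.
\<close>

definition is_norm :: "('a::real_vector \<Rightarrow> real) \<Rightarrow> bool" where
  "is_norm f \<longleftrightarrow>
     (\<forall>x. 0 \<le> f x) \<and>
     (\<forall>x. f x = 0 \<longleftrightarrow> x = 0) \<and>
     (\<forall>x y. f (x + y) \<le> f x + f y) \<and>
     (\<forall>a x. f (a *\<^sub>R x) = \<bar>a\<bar> * f x)"

definition is_inner_product :: "('a::real_vector \<Rightarrow> 'a \<Rightarrow> real) \<Rightarrow> bool" where
  "is_inner_product ip \<longleftrightarrow>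
     bilinear ip \<and>
     (\<forall>x y. ip x y = ip y x) \<and>
     (\<forall>x. 0 \<le> ip x x) \<and>
     (\<forall>x. ip x x = 0 \<longleftrightarrow> x = 0)"

definition norm_induced_by_inner_product :: "('a::real_vector \<Rightarrow> real) \<Rightarrow> bool" where
  "norm_induced_by_inner_product f \<longleftrightarrow>
     is_norm f \<and> (\<exists>ip. is_inner_product ip \<and> (\<forall>x. f x = sqrt (ip x x)))"

definition positively_homogeneous :: "('a::real_vector \<Rightarrow> real) \<Rightarrow> bool" where
  "positively_homogeneous f \<longleftrightarrow> (\<forall>a x. 0 \<le> a \<longrightarrow> f (a *\<^sub>R x) = a * f x)"

definition parallelogram_law :: "('a::real_vector \<Rightarrow> real) \<Rightarrow> bool" where
  "parallelogram_law f \<longleftrightarrow>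
     (\<forall>x y. (f (x + y))\<^sup>2 + (f (x - y))\<^sup>2 = 2 * ((f x)\<^sup>2 + (f y)\<^sup>2))"

end

theory Submission
  imports Defs
begin

text \<open>
  The polar form of the square of \<open>f\<close> is additive by the parallelogram law alone. Homogeneity of
  the polar form in one argument needs no continuity: the additive function
  \<open>t \<mapsto> \<langle>t x, y\<rangle> - t \<langle>x, y\<rangle>\<close> is bounded on the unit interval (again by
  the parallelogram law) and vanishes at 1, so it is 1-periodic and globally bounded, hence zero.
  The triangle inequality for \<open>f\<close> is then Cauchy--Schwarz, not a consequence of the one for
  the metric, which need not be translation-invariant.
\<close>

lemma additive_bounded_zero:
  fixes h :: "real \<Rightarrow> real"
  assumes add: "\<And>s t. h (s + t) = h s + h t"
    and h1: "h 1 = 0"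
    and bnd: "\<And>t. 0 \<le> t \<Longrightarrow> t \<le> 1 \<Longrightarrow> \<bar>h t\<bar> \<le> B"
  shows "h t = 0"
proof -
  interpret additive h by standard (rule add)
  have mult: "h (of_nat n * s) = of_nat n * h s" for n s
    by (induction n) (simp_all add: zero add algebra_simps)
  have hint: "h (of_int k) = 0" for k
    using mult[of "nat k" 1] mult[of "nat (- k)" 1] minus[of "of_int (- k)"] h1
    by (cases "0 \<le> k") auto
  have glob: "\<bar>h s\<bar> \<le> B" for s
  proof -
    have "h s = h (frac s)"
      using add[of "of_int \<lfloor>s\<rfloor>" "frac s"] hint by (simp add: frac_def)
    then show ?thesis
      using bnd[of "frac s"] frac_lt_1[of s] by simp
  qed
  show ?thesis
  proof (rule ccontr)
    \<comment> \<open>A nonzero value is amplified along the multiples of \<open>t\<close>: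
      \<open>h (of_nat n * t)\<close> is \<open>of_nat n * h t\<close>, which eventually exceeds
      \<open>B\<close>.\<close>
    assume "h t \<noteq> 0"
    then obtain n :: nat where "B < of_nat n * \<bar>h t\<bar>"
      using reals_Archimedean3[of "\<bar>h t\<bar>"] by auto
    then show False
      using glob[of "of_nat n * t"] by (simp add: mult abs_mult)
  qed
qed

text \<open>Polarization identity: any inner product inducing \<open>f\<close> has to be this
  function.\<close>

definition polar_form :: "('a::real_vector \<Rightarrow> real) \<Rightarrow> 'a \<Rightarrow> 'a \<Rightarrow> real" where
  "polar_form f x y = ((f (x + y))\<^sup>2 - (f (x - y))\<^sup>2) / 4"

lemma four_polar_form: "4 * polar_form f x y = (f (x + y))\<^sup>2 - (f (x - y))\<^sup>2"
  by (simp add: polar_form_def)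

context
  fixes f :: "'a::real_vector \<Rightarrow> real"
  assumes hom: "positively_homogeneous f"
    and par: "parallelogram_law f"
begin

lemma parallelogram: "(f (x + y))\<^sup>2 + (f (x - y))\<^sup>2 = 2 * ((f x)\<^sup>2 + (f y)\<^sup>2)"
  using par unfolding parallelogram_law_def by blast

lemma zero_at_zero: "f 0 = 0"
  using hom unfolding positively_homogeneous_def by (metis mult_zero_left order_refl scaleR_zero_left)

text \<open>Positive homogeneity does not relate \<open>x\<close> to \<open>- x\<close>; the
  parallelogram law centred at 0 does. As \<open>f\<close> has no assumed sign in this context, only
  the squares can be compared.\<close>

lemma square_even: "(f (- x))\<^sup>2 = (f x)\<^sup>2"
  using parallelogram[of 0 x] by (simp add: zero_at_zero)

lemma square_scaleR: "(f (a *\<^sub>R x))\<^sup>2 = a\<^sup>2 * (f x)\<^sup>2"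
proof (cases "0 \<le> a")
  case True
  then show ?thesis
    using hom by (simp add: positively_homogeneous_def power_mult_distrib)
next
  case False
  then have "f ((- a) *\<^sub>R x) = - a * f x"
    using hom unfolding positively_homogeneous_def by (meson linear neg_0_le_iff_le)
  then show ?thesis
    using square_even[of "a *\<^sub>R x"] by (simp add: power_mult_distrib)
qed

lemma polar_form_commute: "polar_form f x y = polar_form f y x"
  using square_even[of "x - y"] by (simp add: polar_form_def add.commute)

lemma polar_form_self: "polar_form f x x = (f x)\<^sup>2"
  using square_scaleR[of 2 x] by (simp add: polar_form_def zero_at_zero scaleR_2)

lemma polar_form_minus: "polar_form f (- x) y = - polar_form f x y"
  using square_even[of "x + y"] square_even[of "x - y"]
    four_polar_form[of f x y] four_polar_form[of f "- x" y]
  by simp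

lemma polar_form_add: "polar_form f (x + z) y = polar_form f x y + polar_form f z y"
proof -
  \<comment> \<open>Subtract the parallelogram laws for the pairs \<open>u + y\<close>,
    \<open>v\<close> and \<open>u - y\<close>, \<open>v\<close>; the square of \<open>f v\<close>
    cancels.\<close>
  have jensen: "polar_form f (u + v) y + polar_form f (u - v) y = 2 * polar_form f u y" for u v
    using parallelogram[of "u + y" v] parallelogram[of "u - y" v]
      four_polar_form[of f "u + v" y] four_polar_form[of f "u - v" y] four_polar_form[of f u y]
    by (simp add: algebra_simps)
  show ?thesis
    \<comment> \<open>Adding the two instances leaves twice the claim, since the terms at
      \<open>x - z\<close> and \<open>z - x\<close> cancel by oddness.\<close>
    using jensen[of x z] jensen[of z x] polar_form_minus[of "x - z" y] by (simp add: add.commute)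
qed

text \<open>A difference of two nonnegative numbers is bounded by their sum, which the parallelogram
  law evaluates. This weak Cauchy--Schwarz inequality uses no homogeneity of the polar form, so it
  can serve to prove that homogeneity.\<close>

lemma abs_polar_form_le: "\<bar>polar_form f x y\<bar> \<le> ((f x)\<^sup>2 + (f y)\<^sup>2) / 2"
  using parallelogram[of x y] zero_le_power2[of "f (x + y)"] zero_le_power2[of "f (x - y)"]
    four_polar_form[of f x y]
  by linarith

lemma polar_form_scaleR: "polar_form f (a *\<^sub>R x) y = a * polar_form f x y"
proof -
  define h where "h t = polar_form f (t *\<^sub>R x) y - t * polar_form f x y" for t
  have "h a = 0"
  \<comment> \<open>Each of the two terms of \<open>h t\<close> contributes at most half of this
    bound.\<close>
  proof (rule additive_bounded_zero[where h = h and B = "(f x)\<^sup>2 + (f y)\<^sup>2"])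
    show "h (s + t) = h s + h t" for s t
      by (simp add: h_def scaleR_left_distrib polar_form_add algebra_simps)
    show "h 1 = 0"
      by (simp add: h_def)
    show "\<bar>h t\<bar> \<le> (f x)\<^sup>2 + (f y)\<^sup>2" if t: "0 \<le> t" "t \<le> 1" for t
    proof -
      have "t\<^sup>2 * (f x)\<^sup>2 \<le> 1 * (f x)\<^sup>2"
        using t by (intro mult_right_mono) (auto simp: power_le_one)
      then have 1: "\<bar>polar_form f (t *\<^sub>R x) y\<bar> \<le> ((f x)\<^sup>2 + (f y)\<^sup>2) / 2"
        using abs_polar_form_le[of "t *\<^sub>R x" y] by (simp add: square_scaleR)
      have "\<bar>t * polar_form f x y\<bar> \<le> 1 * \<bar>polar_form f x y\<bar>"
        unfolding abs_mult using t by (intro mult_right_mono) auto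
      then have 2: "\<bar>t * polar_form f x y\<bar> \<le> ((f x)\<^sup>2 + (f y)\<^sup>2) / 2"
        using abs_polar_form_le[of x y] by simp
      show ?thesis
        unfolding h_def
        by (rule order_trans[OF abs_triangle_ineq4 order_trans[OF add_mono[OF 1 2]]]) simp
    qed
  qed
  then show ?thesis
    by (simp add: h_def)
qed

lemma bilinear_polar_form: "bilinear (polar_form f)"
proof -
  have "linear (\<lambda>x. polar_form f x y)" for y
    by (rule linearI) (simp_all add: polar_form_add polar_form_scaleR)
  moreover have "polar_form f x = (\<lambda>y. polar_form f y x)" for x
    by (intro ext polar_form_commute)
  ultimately show ?thesis
    unfolding bilinear_def by metis
qed

text \<open>Cauchy--Schwarz by rescaling: \<open>f y *\<^sub>R x\<close> and
  \<open>f x *\<^sub>R y\<close> have the same length \<open>f x * f y\<close>, so the weak bound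
  for them becomes the sharp one after division by \<open>f x * f y\<close>.\<close>

lemma polar_form_le:
  assumes nonneg: "\<And>x. 0 \<le> f x" and definite: "\<And>x. f x = 0 \<longleftrightarrow> x = 0"
  shows "polar_form f x y \<le> f x * f y"
proof (cases "x = 0 \<or> y = 0")
  case True
  then show ?thesis
    using polar_form_scaleR[of 0 x y] polar_form_scaleR[of 0 y x] polar_form_commute[of x y]
    by (auto simp: zero_at_zero)
next
  case False
  then have pos: "0 < f x" "0 < f y"
    using nonneg definite by (auto simp: less_le)
  have "polar_form f (f y *\<^sub>R x) (f x *\<^sub>R y) = f x * f y * polar_form f x y"
    using polar_form_commute[of x "f x *\<^sub>R y"] polar_form_commute[of x y]
    by (simp add: polar_form_scaleR)
  moreover have "polar_form f (f y *\<^sub>R x) (f x *\<^sub>R y) \<le> f x * f y * (f x * f y)"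
    using abs_polar_form_le[of "f y *\<^sub>R x" "f x *\<^sub>R y"]
    unfolding square_scaleR by (simp add: power2_eq_square algebra_simps)
  ultimately show ?thesis
    using pos by simp
qed

text \<open>Nonnegativity turns relations between squares back into relations for \<open>f\<close>;
  definiteness passes to \<open>polar_form f\<close>, whose diagonal is the square of
  \<open>f\<close>.\<close>

lemma norm_induced_by_polar_form:
  assumes nonneg: "\<And>x. 0 \<le> f x" and definite: "\<And>x. f x = 0 \<longleftrightarrow> x = 0"
  shows "norm_induced_by_inner_product f"
proof -
  have triangle: "f (x + y) \<le> f x + f y" for x y
  proof (rule power2_le_imp_le)
    have "(f (x + y))\<^sup>2 = (f x)\<^sup>2 + (f y)\<^sup>2 + 2 * polar_form f x y"
      using parallelogram[of x y] by (simp add: polar_form_def field_simps)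
    then show "(f (x + y))\<^sup>2 \<le> (f x + f y)\<^sup>2"
      using polar_form_le[OF nonneg definite, of x y] by (simp add: power2_sum)
  qed (simp add: nonneg)
  have "f (a *\<^sub>R x) = \<bar>a\<bar> * f x" for a x
    by (rule power2_eq_imp_eq) (simp_all add: square_scaleR power_mult_distrib nonneg)
  then have "is_norm f"
    unfolding is_norm_def using nonneg definite triangle by blast
  moreover have "is_inner_product (polar_form f)"
    unfolding is_inner_product_def
    using bilinear_polar_form polar_form_commute by (auto simp: polar_form_self definite)
  moreover have "f x = sqrt (polar_form f x x)" for x
    by (simp add: polar_form_self nonneg)
  ultimately show ?thesis
    unfolding norm_induced_by_inner_product_def by blast
qed

end

text \<open>In the bilinear expansion the cross terms of \<open>x + y\<close> and
  \<open>x - y\<close> cancel.\<close>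

lemma norm_induced_parallelogram:
  assumes "norm_induced_by_inner_product f"
  shows "parallelogram_law f"
proof -
  from assms obtain ip where ip: "is_inner_product ip" and f: "\<And>x. f x = sqrt (ip x x)"
    unfolding norm_induced_by_inner_product_def by blast
  then have bil: "bilinear ip" and sq: "\<And>x. (f x)\<^sup>2 = ip x x"
    by (auto simp: is_inner_product_def)
  show ?thesis
    unfolding parallelogram_law_def sq
    by (simp add: bilinear_ladd[OF bil] bilinear_radd[OF bil] bilinear_lsub[OF bil]
        bilinear_rsub[OF bil])
qed

theorem theorem16:
  fixes d :: "'a::real_vector \<Rightarrow> 'a \<Rightarrow> real" and f :: "'a \<Rightarrow> real"
  assumes "Metric_space UNIV d"
    and "\<And>x. f x = d x 0"
  shows "(norm_induced_by_inner_product f \<longrightarrow> parallelogram_law f) \<and>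
         (positively_homogeneous f \<longrightarrow> parallelogram_law f \<longrightarrow> norm_induced_by_inner_product f)"
proof -
  interpret Metric_space UNIV d by fact
  have "0 \<le> f x" "f x = 0 \<longleftrightarrow> x = 0" for x
    by (simp_all add: assms(2))
  then show ?thesis
    using norm_induced_parallelogram norm_induced_by_polar_form by blast
qed

end
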